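(* Let $k\ge 1$. There exists a set of functionals $\{\psi_\alpha : \alpha\in A\}\subseteq \mathcal{K}(1)$ such that for all $g\in\mathcal{G}_k$, $$g=\sum_{\alpha\in A}\psi_\alpha\, g^\alpha .$$
   Context: $\mathcal{R}_k=[0,1]^k$. $A=\{0,1\}^k$ is the set of all sequences $\alpha=(\alpha_1,\ldots,\alpha_k)$ of zeros and ones. For $\alpha\in A$, $|\alpha|=\sum_j\alpha_j$, and for a function $g$ on $\mathcal{R}_k$, $$g^\alpha(x)=\frac{\partial^{|\alpha|}g(x)}{\partial x_{i_1}\cdots\partial x_{i_{|\alpha|}}},$$ where $i_1<\cdots<i_{|\alpha|}$ are the indices $i$ with $\alpha_i=1$ (so $g^{(0,\ldots,0)}=g$). $\mathcal{B}_k$ is the class of bounded (measurable) real functions on $\mathcal{R}_k$, and $\mathcal{G}_k$ is the class of functions $g$ on $\mathcal{R}_k$ for which $g^\alpha$ is well defined and $g^\alpha\in\mathcal{B}_k$ for every $\alpha\in A$. For $C>0$, $\mathcal{K}(C)$ is the class of functionals $\psi$ (mapping functions on $\mathcal{R}_k$ to functions on $\mathcal{R}_k$) that can be represented as $$(\psi g)(x)=\int_{\mathcal{R}_k}\chi(u,x)\,g(u)\,du\qquad\text{for all } g\in\mathcal{B}_k,$$ where the function $\chi$ (which determines $\psi$) satisfies $\sup_{u,x\in\mathcal{R}_k}|\chi(u,x)|\le C$. The functionals $\psi_\alpha$ in the claim do not depend on $g$. *)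

theory Defs
  imports "HOL-Analysis.Analysis"
begin

text \<open>
  The dimension \<open>k \<ge> 1\<close> is \<open>CARD('n)\<close> for a finite index type \<open>'n\<close>; its linear order
  plays the role of the order on \<open>{1, \<dots>, k}\<close>.  A function on the unit cube is represented by
  a total function on \<open>real ^ 'n\<close>, and only its values on the cube are ever constrained or used.
\<close>

definition ucube :: "(real ^ 'n) set" where
  "ucube = {x. \<forall>i. 0 \<le> x $ i \<and> x $ i \<le> 1}"

definition zero_one_seqs :: "(nat ^ 'n) set" where
  "zero_one_seqs = {\<alpha>. \<forall>i. \<alpha> $ i \<in> {0, 1}}"

lemma finite_zero_one_seqs: "finite (zero_one_seqs :: (nat ^ 'n::finite) set)"
proof -
  have "zero_one_seqs \<subseteq> vec_lambda ` (PiE UNIV (\<lambda>_::'n. {0, 1::nat}))"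
  proof
    fix \<alpha> :: "nat ^ 'n"
    assume "\<alpha> \<in> zero_one_seqs"
    then have "vec_nth \<alpha> \<in> PiE UNIV (\<lambda>_. {0, 1})"
      by (simp add: zero_one_seqs_def PiE_def Pi_def)
    then have "vec_lambda (vec_nth \<alpha>) \<in> vec_lambda ` (PiE UNIV (\<lambda>_::'n. {0, 1::nat}))"
      by (rule imageI)
    then show "\<alpha> \<in> vec_lambda ` (PiE UNIV (\<lambda>_. {0, 1}))"
      by simp
  qed
  then show ?thesis
    by (rule finite_subset) (simp add: finite_PiE)
qed

definition vec_upd :: "real ^ 'n \<Rightarrow> 'n \<Rightarrow> real \<Rightarrow> real ^ 'n" where
  "vec_upd x i t = (\<chi> j. if j = i then t else x $ j)"

text \<open>
  Partial derivatives are taken within the cube, hence are one-sided on its faces.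
\<close>

definition partially_differentiable :: "'n \<Rightarrow> (real ^ 'n \<Rightarrow> real) \<Rightarrow> bool" where
  "partially_differentiable i g \<longleftrightarrow>
     (\<forall>x\<in>ucube. (\<lambda>t. g (vec_upd x i t)) differentiable (at (x $ i) within {0..1}))"

definition partial_deriv :: "'n \<Rightarrow> (real ^ 'n \<Rightarrow> real) \<Rightarrow> real ^ 'n \<Rightarrow> real" where
  "partial_deriv i g x =
     vector_derivative (\<lambda>t. g (vec_upd x i t)) (at (x $ i) within {0..1})"

lemma partial_deriv_eq:
  assumes "x \<in> ucube"
    and "((\<lambda>t. g (vec_upd x i t)) has_real_derivative D) (at (x $ i) within {0..1})"
  shows "partial_deriv i g x = D"
proof -
  have "x $ i \<in> cbox 0 1"
    using assms(1) by (simp add: ucube_def)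
  moreover have "((\<lambda>t. g (vec_upd x i t)) has_vector_derivative D) (at (x $ i) within cbox 0 1)"
    using assms(2) by (simp add: has_real_derivative_iff_has_vector_derivative)
  ultimately show ?thesis
    using vector_derivative_within_cbox[of 0 1 "x $ i" "\<lambda>t. g (vec_upd x i t)" D]
    by (simp add: partial_deriv_def)
qed

text \<open>
  For a list \<open>[i\<^sub>1, \<dots>, i\<^sub>r]\<close> this is
  \<open>\<partial>/\<partial>x\<^bsub>i\<^sub>1\<^esub> (\<dots> (\<partial>g/\<partial>x\<^bsub>i\<^sub>r\<^esub>))\<close>: the last index is differentiated first.
\<close>

fun iterated_partial :: "'n list \<Rightarrow> (real ^ 'n \<Rightarrow> real) \<Rightarrow> real ^ 'n \<Rightarrow> real" where
  "iterated_partial [] g = g"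
| "iterated_partial (i # is) g = partial_deriv i (iterated_partial is g)"

fun iterated_partial_exists :: "'n list \<Rightarrow> (real ^ 'n \<Rightarrow> real) \<Rightarrow> bool" where
  "iterated_partial_exists [] g \<longleftrightarrow> True"
| "iterated_partial_exists (i # is) g \<longleftrightarrow>
     iterated_partial_exists is g \<and> partially_differentiable i (iterated_partial is g)"

definition support_list :: "nat ^ 'n::{finite,linorder} \<Rightarrow> 'n list" where
  "support_list \<alpha> = sorted_list_of_set {i. \<alpha> $ i = 1}"

definition mixed_partial ::
    "nat ^ 'n::{finite,linorder} \<Rightarrow> (real ^ 'n::{finite,linorder} \<Rightarrow> real) \<Rightarrow> real ^ 'n::{finite,linorder} \<Rightarrow> real" where
  "mixed_partial \<alpha> g = iterated_partial (support_list \<alpha>) g"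

definition mixed_partial_exists ::
    "nat ^ 'n::{finite,linorder} \<Rightarrow> (real ^ 'n::{finite,linorder} \<Rightarrow> real) \<Rightarrow> bool" where
  "mixed_partial_exists \<alpha> g \<longleftrightarrow> iterated_partial_exists (support_list \<alpha>) g"

definition class_B :: "(real ^ 'n \<Rightarrow> real) set" where
  "class_B = {g. g \<in> borel_measurable (lebesgue_on ucube) \<and> bounded (g ` ucube)}"

definition class_G :: "(real ^ 'n::{finite,linorder} \<Rightarrow> real) set" where
  "class_G = {g. \<forall>\<alpha>\<in>zero_one_seqs. mixed_partial_exists \<alpha> g \<and> mixed_partial \<alpha> g \<in> class_B}"

text \<open>
  Measurability of the kernel in the integration variable is required so that the integral is
  a genuine Lebesgue integral for every \<open>g \<in> class_B\<close>; otherwise it could take the default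
  value \<open>0\<close> of a non-integrable function.
\<close>

definition class_K :: "real \<Rightarrow> ((real ^ 'n \<Rightarrow> real) \<Rightarrow> (real ^ 'n \<Rightarrow> real)) set" where
  "class_K C = {\<psi>. \<exists>ker :: real ^ 'n \<Rightarrow> real ^ 'n \<Rightarrow> real.
     (\<forall>x\<in>ucube. (\<lambda>u. ker u x) \<in> borel_measurable (lebesgue_on ucube)) \<and>
     (\<forall>u\<in>ucube. \<forall>x\<in>ucube. \<bar>ker u x\<bar> \<le> C) \<and>
     (\<forall>g\<in>class_B. \<forall>x\<in>ucube. \<psi> g x = (\<integral>u. ker u x * g u \<partial>lebesgue_on ucube))}"

end

theory Submission
  imports Defs
begin

text \<open>
  In one variable, integrating \<open>t h'(t)\<close> by parts over \<open>[0, x]\<close> and \<open>(t - 1) h'(t)\<close> over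
  \<open>[x, 1]\<close> gives
  \[ h(x) = \int_0^1 h(t)\,dt + \int_0^1 \kappa(t, x) h'(t)\,dt, \]
  where \<open>\<kappa>(t, x)\<close> is \<open>t\<close> for \<open>t \<le> x\<close> and \<open>t - 1\<close> for \<open>t > x\<close>, so that \<open>\<bar>\<kappa>\<bar> \<le> 1\<close>
  (\<open>sawtooth_representation\<close>).  Applied to one coordinate after the other, this represents \<open>g\<close> by its
  mixed partial derivatives with the kernels \<open>\<Prod>i | \<alpha> $ i = 1. \<kappa> (u $ i) (x $ i)\<close>, which are
  still bounded by 1.

  The induction is over a set \<open>S\<close> of coordinates that have already been replaced by integration
  variables (\<open>class_G_partial_expansion\<close>).  The derivative \<open>g\<^sup>\<alpha>\<close> differentiates in the largest
  coordinate first, and derivatives taken in another order need not exist or agree with it; hence the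
  coordinates join \<open>S\<close> in decreasing order, and the identity for the new coordinate \<open>j\<close> is applied to \<open>g\<^sup>\<alpha>\<close> with \<open>\<alpha>\<close>
  supported above \<open>j\<close>, whose \<open>j\<close>-th partial derivative is again one of the given derivatives.  The
  induction step (\<open>absorb_coordinate\<close>) integrates this identity over the cube; the only form of
  Fubini's theorem that it uses is that refreshing one coordinate of a uniformly distributed point
  of the cube changes no integral (\<open>cube_integral_coordinate\<close>).

  The identity in \<open>j\<close> is needed on every line parallel to the \<open>j\<close>-th axis, in particular on those
  of a lower-dimensional slice through \<open>x\<close>, where Lebesgue measurability on the cube says nothing.
  This is why Borel measurability is established first: bounded first partial derivatives make \<open>g\<close>
  Lipschitz, hence continuous, and every partial derivative of a Borel function is Borel, as a limit
  of difference quotients (\<open>class_G_bounded_borel\<close>).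
\<close>

section \<open>Changing one coordinate of a point of the cube\<close>

lemma vec_upd_nth [simp]: "vec_upd x i t $ j = (if j = i then t else x $ j)"
  by (simp add: vec_upd_def)

lemma vec_upd_overwrite [simp]: "vec_upd (vec_upd x i s) i t = vec_upd x i t"
  by (simp add: vec_eq_iff)

lemma vec_upd_same [simp]: "vec_upd x i (x $ i) = x"
  by (simp add: vec_eq_iff)

lemma vec_upd_in_ucube: "x \<in> ucube \<Longrightarrow> t \<in> {0..1} \<Longrightarrow> vec_upd x i t \<in> ucube"
  by (simp add: ucube_def)

lemma vec_upd_in_ucube_iff: "vec_upd x i t \<in> ucube \<longleftrightarrow> t \<in> {0..1} \<and> vec_upd x i 0 \<in> ucube"
  by (auto simp: ucube_def)

lemma ucube_nth: "x \<in> ucube \<Longrightarrow> x $ i \<in> {0..1}"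
  by (simp add: ucube_def)

lemma ucube_eq_cbox: "(ucube :: (real ^ 'n::finite) set) = cbox 0 1"
  by (auto simp: ucube_def mem_box_cart)

lemma borel_ucube [measurable]: "(ucube :: (real ^ 'n::finite) set) \<in> sets borel"
  by (simp add: ucube_eq_cbox)

lemma emeasure_ucube_finite: "emeasure lborel (ucube :: (real ^ 'n::finite) set) < \<infinity>"
  by (simp add: ucube_eq_cbox emeasure_lborel_cbox_eq)

lemma measure_ucube: "measure lborel (ucube :: (real ^ 'n::finite) set) = 1"
proof -
  have "cbox 0 (1 :: real ^ 'n) \<noteq> {}"
    by (simp add: interval_ne_empty_cart)
  then show ?thesis
    unfolding ucube_eq_cbox by (subst content_cbox_cart) auto
qed

lemma borel_measurable_vec_upd [measurable]:
  "(\<lambda>p :: (real ^ 'n::finite) \<times> real. vec_upd (fst p) i (snd p)) \<in> borel_measurable borel"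
proof -
  have "continuous_on UNIV (\<lambda>p :: (real ^ 'n) \<times> real. if j = i then snd p else fst p $ j)" for j
    by (cases "j = i") (auto intro!: continuous_intros)
  then show ?thesis
    unfolding vec_upd_def by (intro borel_measurable_continuous_onI continuous_on_vec_lambda)
qed

lemma borel_measurable_vec_upd_line [measurable]:
  "vec_upd (x :: real ^ 'n::finite) i \<in> borel_measurable borel"
proof -
  have "vec_upd x i = (\<lambda>t. x + (t - x $ i) *\<^sub>R axis i 1)"
    by (auto simp: vec_eq_iff axis_def fun_eq_iff)
  then show ?thesis by simp
qed

section \<open>Fubini in one coordinate\<close>

text \<open>
  Lebesgue measure on \<open>real ^ 'n\<close> is the image of a product measure indexed by the basis vectors, and
  this index set can be split off one element.  The summand \<open>f (axis i 1)\<close> of the point on the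
  right-hand side is meaningless under the integral over the other coordinates, but it is overwritten.
\<close>

lemma integral_lborel_split_coordinate:
  fixes F :: "real ^ 'n::finite \<Rightarrow> real" and i :: 'n
  assumes F: "integrable lborel F"
  defines "I \<equiv> Basis - {axis i (1::real)}"
  shows "integral\<^sup>L lborel F =
    (\<integral>f. \<integral>t. F (vec_upd (\<Sum>b\<in>Basis. f b *\<^sub>R b) i t) \<partial>lborel \<partial>Pi\<^sub>M I (\<lambda>_. lborel))"
proof -
  interpret product_sigma_finite "\<lambda>_ :: real ^ 'n. lborel :: real measure" ..
  define \<Phi> :: "(real ^ 'n \<Rightarrow> real) \<Rightarrow> real ^ 'n" where "\<Phi> f = (\<Sum>b\<in>Basis. f b *\<^sub>R b)" for f
  have ax: "axis i 1 \<in> (Basis :: (real ^ 'n) set)"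
    by (simp add: axis_in_Basis_iff)
  then have B: "insert (axis i 1) I = Basis"
    by (auto simp: I_def)
  have [measurable]: "F \<in> borel_measurable borel"
    using F by auto
  have \<Phi> [measurable]: "\<Phi> \<in> Pi\<^sub>M Basis (\<lambda>_. lborel) \<rightarrow>\<^sub>M borel"
    unfolding \<Phi>_def by measurable
  have lb: "lborel = distr (Pi\<^sub>M Basis (\<lambda>_. lborel)) borel \<Phi>"
    unfolding \<Phi>_def by (rule lborel_eq)
  have nth: "\<Phi> f $ j = f (axis j 1)" for f j
  proof -
    have "\<Phi> f \<bullet> axis j 1 = f (axis j 1)"
      unfolding \<Phi>_def by (rule inner_sum_left_Basis) (simp add: axis_in_Basis_iff)
    then show ?thesis by (simp add: inner_axis)
  qed
  have upd: "\<Phi> (f(axis i 1 := t)) = vec_upd (\<Phi> f) i t" for f t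
    by (simp add: vec_eq_iff[of "\<Phi> (f(axis i 1 := t))"] nth axis_eq_axis)
  have int: "integrable (Pi\<^sub>M (insert (axis i 1) I) (\<lambda>_. lborel)) (\<lambda>f. F (\<Phi> f))"
    unfolding B using F by (subst (asm) lb, subst (asm) integrable_distr_eq) auto
  have "integral\<^sup>L lborel F = (\<integral>f. F (\<Phi> f) \<partial>Pi\<^sub>M (insert (axis i 1) I) (\<lambda>_. lborel))"
    unfolding B by (subst lb, subst integral_distr) auto
  also have "\<dots> = (\<integral>f. \<integral>t. F (\<Phi> (f(axis i 1 := t))) \<partial>lborel \<partial>Pi\<^sub>M I (\<lambda>_. lborel))"
    by (rule product_integral_insert[OF _ _ int]) (auto simp: I_def)
  finally show ?thesis
    unfolding upd by (simp add: \<Phi>_def)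
qed

lemma set_integrable_ucube:
  fixes F :: "real ^ 'n::finite \<Rightarrow> real"
  assumes "F \<in> borel_measurable (restrict_space borel ucube)" "\<And>u. u \<in> ucube \<Longrightarrow> \<bar>F u\<bar> \<le> B"
  shows "set_integrable lborel ucube F"
  unfolding set_integrable_def
proof (rule integrableI_bounded_set[where A = ucube and B = B])
  show "(\<lambda>x. indicat_real ucube x *\<^sub>R F x) \<in> borel_measurable lborel"
    using assms(1) by (subst (asm) borel_measurable_restrict_space_iff) auto
qed (use assms(2) emeasure_ucube_finite in auto)

text \<open>
  After splitting off the \<open>i\<close>-th coordinate, the inner integrals of both sides are equal: on the right the
  inner integrand is constant along the unit interval, an interval of length 1.
\<close>

lemma cube_integral_coordinate:
  fixes F :: "real ^ 'n::finite \<Rightarrow> real"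
  assumes F: "F \<in> borel_measurable (restrict_space borel ucube)"
    and B: "\<And>u. u \<in> ucube \<Longrightarrow> \<bar>F u\<bar> \<le> B"
  shows "(LINT u:ucube|lborel. F u) = (LINT u:ucube|lborel. LINT t:{0..1}|lborel. F (vec_upd u i t))"
proof -
  \<comment> \<open>Extension by 0 reduces the claim to integrals over the whole space.\<close>
  define G where "G u = indicator ucube u * F u" for u
  have G [measurable]: "G \<in> borel_measurable borel"
    using F unfolding G_def by (subst (asm) borel_measurable_restrict_space_iff) auto
  have GB: "\<bar>G u\<bar> \<le> \<bar>B\<bar>" for u
    using B[of u] by (auto simp: G_def indicator_def)
  have G_upd: "G (vec_upd y i t) = indicator ucube (vec_upd y i 0) * (indicator {0..1} t * F (vec_upd y i t))"
    for y t
    using vec_upd_in_ucube_iff[of y i t] by (auto simp: G_def indicator_def)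
  define K where "K u = indicator ucube u * (\<integral>t. indicator {0..1} t * F (vec_upd u i t) \<partial>lborel)" for u
  \<comment> \<open>Replacing \<open>F\<close> by its Borel extension \<open>G\<close> makes \<open>K\<close> visibly Borel.\<close>
  have K_alt: "K u = indicator ucube u * (\<integral>t. indicator {0..1} t * G (vec_upd u i t) \<partial>lborel)" for u
    unfolding K_def G_upd
    by (auto simp: indicator_def vec_upd_in_ucube intro!: Bochner_Integration.integral_cong)
  have [measurable]: "(\<lambda>p :: (real ^ 'n) \<times> real. G (vec_upd (fst p) i (snd p))) \<in> borel_measurable (borel \<Otimes>\<^sub>M borel)"
    unfolding borel_prod by measurable
  have K_meas [measurable]: "K \<in> borel_measurable borel"
    unfolding K_alt[abs_def]
    by (intro borel_measurable_times lborel.borel_measurable_lebesgue_integral)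
       (auto simp: case_prod_beta')
  have KB: "\<bar>K u\<bar> \<le> \<bar>B\<bar>" for u
  proof -
    have i1: "integrable lborel (\<lambda>t :: real. indicator {0..1} t * \<bar>B\<bar>)" by simp
    have "\<bar>\<integral>t. indicator {0..1} t * G (vec_upd u i t) \<partial>lborel\<bar> \<le> (\<integral>t. indicator {0..1::real} t * \<bar>B\<bar> \<partial>lborel)"
    proof (rule Bochner_Integration.integral_abs_bound_integral[OF _ i1])
      show "integrable lborel (\<lambda>t. indicator {0..1} t * G (vec_upd u i t))"
        using GB by (intro Bochner_Integration.integrable_bound[OF i1]) (auto simp: indicator_def)
    qed (use GB in \<open>auto simp: indicator_def\<close>)
    also have "\<dots> = \<bar>B\<bar>" by simp
    finally show ?thesis
      unfolding K_alt by (cases "u \<in> ucube") auto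
  qed
  have int: "integrable lborel G" "integrable lborel K"
  proof -
    have "(\<lambda>u. indicator ucube u *\<^sub>R G u) = G" "(\<lambda>u. indicator ucube u *\<^sub>R K u) = K"
      by (auto simp: G_def K_def indicator_def fun_eq_iff)
    then show "integrable lborel G" "integrable lborel K"
      using set_integrable_ucube[OF measurable_restrict_space1[OF G] GB]
        set_integrable_ucube[OF measurable_restrict_space1[OF K_meas] KB]
      unfolding set_integrable_def by simp_all
  qed
  have "(\<integral>t. G (vec_upd y i t) \<partial>lborel) = (\<integral>t. K (vec_upd y i t) \<partial>lborel)" for y
  proof -
    have eq: "indicator ucube (vec_upd y i t) =
        (indicator ucube (vec_upd y i 0) * indicator {0..1} t :: real)" for t
      using vec_upd_in_ucube_iff[of y i t] by (auto simp: indicator_def)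
    have "K (vec_upd y i t) = indicator {0..1} t * (indicator ucube (vec_upd y i 0) *
        (\<integral>t. indicator {0..1} t * F (vec_upd y i t) \<partial>lborel))" for t
      unfolding K_def eq[of t] by (simp add: mult_ac)
    then show ?thesis
      by (simp add: G_upd)
  qed
  then have "integral\<^sup>L lborel G = integral\<^sup>L lborel K"
    using integral_lborel_split_coordinate[OF int(1), of i]
      integral_lborel_split_coordinate[OF int(2), of i] by simp
  then show ?thesis
    by (simp add: set_lebesgue_integral_def G_def[abs_def] K_def[abs_def])
qed

section \<open>The one-dimensional representation\<close>

text \<open>
  For \<open>x\<close> inside the unit interval, this is as a function of \<open>t\<close> the piecewise linear function of
  slope 1 that vanishes at 0 and 1 and drops by 1 just after \<open>x\<close>: the Peano kernel of the functional
  that maps \<open>h\<close> to \<open>h(x)\<close> minus its mean.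
\<close>

definition sawtooth :: "real \<Rightarrow> real \<Rightarrow> real" where
  "sawtooth t x = (if t \<le> x then t else t - 1)"

lemma abs_sawtooth_le_1: "t \<in> {0..1} \<Longrightarrow> \<bar>sawtooth t x\<bar> \<le> 1"
  by (auto simp: sawtooth_def)

lemma borel_measurable_sawtooth [measurable]: "(\<lambda>t. sawtooth t x) \<in> borel_measurable borel"
  unfolding sawtooth_def by measurable

text \<open>
  The integral is a gauge integral because \<open>h'\<close> is an arbitrary derivative, for which the fundamental
  theorem of calculus holds in the sense of that integral.
\<close>

lemma has_integral_sawtooth:
  fixes h :: "real \<Rightarrow> real"
  assumes x: "x \<in> {0..1}"
    and h: "\<And>t. t \<in> {0..1} \<Longrightarrow> (h has_real_derivative h' t) (at t within {0..1})"
  shows "((\<lambda>t. h t + sawtooth t x * h' t) has_integral h x) {0..1}"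
proof -
  \<comment> \<open>The integrand is the derivative of \<open>(t - c) h(t)\<close>; the choices \<open>c = 0\<close> on \<open>[0, x]\<close> and
    \<open>c = 1\<close> on \<open>[x, 1]\<close> kill the boundary terms at 0 and 1.\<close>
  have ibp: "((\<lambda>t. h t + (t - c) * h' t) has_integral (b - c) * h b - (a - c) * h a) {a..b}"
    if "0 \<le> a" "a \<le> b" "b \<le> 1" for a b c
  proof (rule fundamental_theorem_of_calculus[OF \<open>a \<le> b\<close>])
    fix t assume t: "t \<in> {a..b}"
    have "(h has_real_derivative h' t) (at t within {a..b})"
      using t that by (intro DERIV_subset[OF h]) auto
    from DERIV_mult[OF DERIV_diff[OF DERIV_ident DERIV_const[of c]] this]
    have "((\<lambda>t. (t - c) * h t) has_real_derivative h t + (t - c) * h' t) (at t within {a..b})"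
      by (simp add: mult.commute)
    then show "((\<lambda>t. (t - c) * h t) has_vector_derivative h t + (t - c) * h' t) (at t within {a..b})"
      by (simp add: has_real_derivative_iff_has_vector_derivative)
  qed
  have "((\<lambda>t. h t + sawtooth t x * h' t) has_integral (x - 0) * h x - (0 - 0) * h 0) {0..x}"
    using x by (intro has_integral_eq[OF _ ibp[of 0 x 0]]) (auto simp: sawtooth_def)
  \<comment> \<open>At the single point \<open>t = x\<close> the kernel is \<open>x\<close> and not \<open>x - 1\<close>.\<close>
  moreover have "((\<lambda>t. h t + sawtooth t x * h' t) has_integral (1 - 1) * h 1 - (x - 1) * h x) {x..1}"
    using x by (intro has_integral_spike_finite[OF _ _ ibp[of x 1 1], of "{x}"])
      (auto simp: sawtooth_def)
  ultimately have "((\<lambda>t. h t + sawtooth t x * h' t) has_integral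
      ((x - 0) * h x - (0 - 0) * h 0) + ((1 - 1) * h 1 - (x - 1) * h x)) {0..1}"
    using x by (intro has_integral_combine[of 0 x 1]) auto
  then show ?thesis
    by (simp add: algebra_simps)
qed

text \<open>
  For a bounded Borel derivative the integrand is Lebesgue integrable, so the gauge integral is a
  Lebesgue integral, which Fubini's theorem and the kernel representation require.
\<close>

lemma sawtooth_representation:
  fixes h :: "real \<Rightarrow> real"
  assumes x: "x \<in> {0..1}"
    and h: "\<And>t. t \<in> {0..1} \<Longrightarrow> (h has_real_derivative h' t) (at t within {0..1})"
    and h': "h' \<in> borel_measurable (restrict_space borel {0..1})"
    and B: "\<And>t. t \<in> {0..1} \<Longrightarrow> \<bar>h' t\<bar> \<le> B"
  shows "h x = (LINT t:{0..1}|lborel. h t + sawtooth t x * h' t)"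
proof -
  have cont: "continuous_on {0..1} h"
    using h by (intro DERIV_continuous_on)
  have "set_integrable lborel {0..1} h"
    by (rule borel_integrable_atLeastAtMost') (fact cont)
  moreover have "set_integrable lborel {0..1} (\<lambda>t. sawtooth t x * h' t)"
    unfolding set_integrable_def
  proof (rule integrableI_bounded_set[where A = "{0..1}" and B = B])
    have "(\<lambda>t. sawtooth t x * h' t) \<in> borel_measurable (restrict_space borel {0..1})"
      by (intro borel_measurable_times h' measurable_restrict_space1) measurable
    then show "(\<lambda>t. indicat_real {0..1} t *\<^sub>R (sawtooth t x * h' t)) \<in> borel_measurable lborel"
      by (subst (asm) borel_measurable_restrict_space_iff) auto
    show "AE t in lborel. t \<in> {0..1} \<longrightarrow> norm (indicat_real {0..1} t *\<^sub>R (sawtooth t x * h' t)) \<le> B"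
    proof (intro AE_I2 impI)
      fix t :: real assume t: "t \<in> {0..1}"
      have "\<bar>sawtooth t x\<bar> * \<bar>h' t\<bar> \<le> 1 * B"
        by (intro mult_mono abs_sawtooth_le_1 B t) auto
      with t show "norm (indicat_real {0..1} t *\<^sub>R (sawtooth t x * h' t)) \<le> B"
        by (simp add: abs_mult)
    qed
  qed auto
  ultimately have "set_integrable lborel {0..1} (\<lambda>t. h t + sawtooth t x * h' t)"
    by (rule set_integral_add)
  then show ?thesis
    using integral_unique[OF has_integral_sawtooth[OF x h]]
    by (simp add: set_borel_integral_eq_integral(2))
qed

section \<open>Regularity from bounded partial derivatives\<close>

lemma partial_deriv_has_derivative:
  assumes "partially_differentiable i f" "y \<in> ucube" "t \<in> {0..1}"
  shows "((\<lambda>s. f (vec_upd y i s)) has_real_derivative partial_deriv i f (vec_upd y i t))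
    (at t within {0..1})"
proof -
  have y: "vec_upd y i t \<in> ucube"
    using assms by (simp add: vec_upd_in_ucube)
  then obtain D where D: "((\<lambda>s. f (vec_upd y i s)) has_real_derivative D) (at t within {0..1})"
    using assms(1) unfolding partially_differentiable_def by (force simp: real_differentiable_def)
  then have "partial_deriv i f (vec_upd y i t) = D"
    using y by (intro partial_deriv_eq) auto
  with D show ?thesis by simp
qed

text \<open>
  The partial derivative is the pointwise limit of Borel difference quotients.
\<close>

lemma borel_measurable_partial_deriv:
  fixes f :: "real ^ 'n::finite \<Rightarrow> real"
  assumes f: "f \<in> borel_measurable (restrict_space borel ucube)"
    and d: "partially_differentiable i f"
  shows "partial_deriv i f \<in> borel_measurable (restrict_space borel ucube)"
proof -
  \<comment> \<open>The increments tend to 0 and point towards the farther of the two faces; being at most 1/2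
    in size, they do not leave the cube.\<close>
  define h :: "nat \<Rightarrow> real ^ 'n \<Rightarrow> real"
    where "h n x = (if x $ i \<le> 1 / 2 then 1 else - 1) / real (n + 2)" for n x
  have h_meas [measurable]: "h n \<in> borel_measurable borel" for n
    unfolding h_def by measurable
  have step: "x $ i + h n x \<in> {0..1}" "h n x \<noteq> 0" if "x \<in> ucube" for x n
  proof -
    define c where "c = 1 / real (n + 2)"
    have "0 < c" "c \<le> 1 / 2"
      by (auto simp: c_def field_simps)
    moreover have "h n x = (if x $ i \<le> 1 / 2 then c else - c)"
      by (simp add: c_def h_def)
    ultimately show "x $ i + h n x \<in> {0..1}" "h n x \<noteq> 0"
      using ucube_nth[OF that, of i] by auto
  qed
  show ?thesis
  proof (rule borel_measurable_LIMSEQ_real)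
    fix x :: "real ^ 'n" assume "x \<in> space (restrict_space borel ucube)"
    then have x: "x \<in> ucube" by (simp add: space_restrict_space)
    have "(\<lambda>n. h n x) \<longlonglongrightarrow> 0"
      unfolding h_def by (intro LIMSEQ_ignore_initial_segment[OF lim_const_over_n])
    then have "filterlim (\<lambda>n. x $ i + h n x) (at (x $ i) within {0..1}) sequentially"
      using step[OF x] by (auto simp: filterlim_at intro!: tendsto_eq_intros)
    moreover have "((\<lambda>s. (f (vec_upd x i s) - f x) / (s - x $ i)) \<longlongrightarrow> partial_deriv i f x)
        (at (x $ i) within {0..1})"
      using partial_deriv_has_derivative[OF d x ucube_nth[OF x, of i]]
      by (simp add: has_field_derivative_iff)
    ultimately have "(\<lambda>n. (f (vec_upd x i (x $ i + h n x)) - f x) / (x $ i + h n x - x $ i))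
        \<longlonglongrightarrow> partial_deriv i f x"
      by (rule filterlim_compose[rotated])
    then show "(\<lambda>n. (f (vec_upd x i (x $ i + h n x)) - f x) / h n x) \<longlonglongrightarrow> partial_deriv i f x"
      by simp
  next
    fix n
    have "vec_upd x i (x $ i + h n x) = x + h n x *\<^sub>R axis i 1" for x
      by (auto simp: vec_eq_iff axis_def)
    then have "(\<lambda>x. vec_upd x i (x $ i + h n x)) \<in> borel_measurable borel"
      by simp
    then have "(\<lambda>x. vec_upd x i (x $ i + h n x)) \<in>
        restrict_space borel ucube \<rightarrow>\<^sub>M restrict_space borel ucube"
      using step by (intro measurable_restrict_space3) (auto intro: vec_upd_in_ucube)
    from measurable_compose[OF this f]
    show "(\<lambda>x. (f (vec_upd x i (x $ i + h n x)) - f x) / h n x)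
        \<in> borel_measurable (restrict_space borel ucube)"
      by (intro borel_measurable_divide borel_measurable_diff f measurable_restrict_space1[OF h_meas])
  qed
qed

text \<open>
  Between \<open>x\<close> and \<open>u\<close> one can move along the coordinate axes; the points \<open>merge_coords S u x\<close> are
  the corners of these paths.
\<close>

definition merge_coords :: "'n set \<Rightarrow> real ^ 'n \<Rightarrow> real ^ 'n \<Rightarrow> real ^ 'n" where
  "merge_coords S u x = (\<chi> i. if i \<in> S then u $ i else x $ i)"

lemma merge_coords_nth [simp]: "merge_coords S u x $ i = (if i \<in> S then u $ i else x $ i)"
  by (simp add: merge_coords_def)

lemma merge_coords_empty [simp]: "merge_coords {} u x = x"
  by (simp add: vec_eq_iff)

lemma merge_coords_UNIV [simp]: "merge_coords UNIV u x = u"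
  by (simp add: vec_eq_iff)

lemma merge_coords_in_ucube: "u \<in> ucube \<Longrightarrow> x \<in> ucube \<Longrightarrow> merge_coords S u x \<in> ucube"
  by (simp add: ucube_def)

lemma merge_coords_insert: "merge_coords (insert j S) u x = vec_upd (merge_coords S u x) j (u $ j)"
  by (auto simp: vec_eq_iff)

lemma merge_coords_vec_upd:
  "merge_coords (insert j S) (vec_upd u j t) x = vec_upd (merge_coords S u x) j t"
  by (auto simp: vec_eq_iff)

text \<open>
  The coordinates of \<open>x\<close> are replaced by those of \<open>u\<close> one at a time, and the mean value inequality
  bounds each change.  The path stays in the cube, where the partial derivatives are bounded.
\<close>

lemma bounded_partials_imp_lipschitz:
  fixes f :: "real ^ 'n::finite \<Rightarrow> real"
  assumes d: "\<And>i. partially_differentiable i f"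
    and L: "\<And>i x. x \<in> ucube \<Longrightarrow> \<bar>partial_deriv i f x\<bar> \<le> L"
    and u: "u \<in> ucube" and x: "x \<in> ucube"
  shows "\<bar>f u - f x\<bar> \<le> L * (\<Sum>i\<in>UNIV. \<bar>u $ i - x $ i\<bar>)"
proof -
  have "\<bar>f (merge_coords S u x) - f x\<bar> \<le> L * (\<Sum>i\<in>S. \<bar>u $ i - x $ i\<bar>)" if "finite S" for S
    using that
  proof (induction S)
    case (insert j S)
    define y where "y = merge_coords S u x"
    have y: "y \<in> ucube" "y $ j = x $ j"
      using u x insert.hyps by (auto simp: y_def merge_coords_in_ucube)
    have "norm (f (vec_upd y j (u $ j)) - f (vec_upd y j (x $ j))) \<le> L * norm (u $ j - x $ j)"
    proof (rule field_differentiable_bound[where S = "{0..1}"])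
      fix t :: real assume "t \<in> {0..1}"
      then show "((\<lambda>t. f (vec_upd y j t)) has_real_derivative partial_deriv j f (vec_upd y j t))
          (at t within {0..1})" "norm (partial_deriv j f (vec_upd y j t)) \<le> L"
        using partial_deriv_has_derivative[OF d y(1)] L vec_upd_in_ucube[OF y(1)] by auto
    qed (use ucube_nth[OF u] ucube_nth[OF x] in auto)
    then have "\<bar>f (merge_coords (insert j S) u x) - f y\<bar> \<le> L * \<bar>u $ j - x $ j\<bar>"
      by (simp add: merge_coords_insert flip: y_def y(2))
    with insert show ?case
      by (simp add: distrib_left flip: y_def)
  qed simp
  from this[of UNIV] show ?thesis by simp
qed

lemma bounded_partials_imp_continuous_on:
  fixes f :: "real ^ 'n::finite \<Rightarrow> real"
  assumes d: "\<And>i. partially_differentiable i f"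
    and bd: "\<And>i. bounded (partial_deriv i f ` ucube)"
  shows "continuous_on ucube f"
proof -
  have "\<forall>i. \<exists>b>0. \<forall>x\<in>ucube. \<bar>partial_deriv i f x\<bar> \<le> b"
    using bd by (auto simp: bounded_pos)
  then obtain b where b: "\<And>i. b i > 0" "\<And>i x. x \<in> ucube \<Longrightarrow> \<bar>partial_deriv i f x\<bar> \<le> b i"
    by metis
  define L where "L = (\<Sum>i\<in>UNIV. b i)"
  have bL: "b i \<le> L" for i
    unfolding L_def by (rule member_le_sum) (auto intro: less_imp_le b)
  then have L: "\<bar>partial_deriv i f x\<bar> \<le> L" if "x \<in> ucube" for i x
    using b(2)[OF that, of i] by (meson order_trans)
  have "L > 0"
    using b(1) bL by (meson less_le_trans)
  show ?thesis
  proof (rule lipschitz_on_continuous_on[of "L * CARD('n)"], rule lipschitz_onI)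
    fix u x :: "real ^ 'n" assume ux: "u \<in> ucube" "x \<in> ucube"
    have "(\<Sum>i\<in>UNIV. \<bar>u $ i - x $ i\<bar>) \<le> (\<Sum>i\<in>(UNIV :: 'n set). norm (u - x))"
      using component_le_norm_cart[of "u - x"] by (intro sum_mono) simp
    then have "L * (\<Sum>i\<in>UNIV. \<bar>u $ i - x $ i\<bar>) \<le> L * (CARD('n) * norm (u - x))"
      using \<open>L > 0\<close> by simp
    with bounded_partials_imp_lipschitz[OF d L ux]
    show "dist (f u) (f x) \<le> L * CARD('n) * dist u x"
      by (simp add: dist_norm mult.assoc)
  qed (use \<open>L > 0\<close> in simp)
qed


section \<open>Absorbing one coordinate into the integral\<close>

definition prod_kernel :: "'n::finite set \<Rightarrow> real ^ 'n \<Rightarrow> real ^ 'n \<Rightarrow> real" where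
  "prod_kernel A u x = (\<Prod>i\<in>A. sawtooth (u $ i) (x $ i))"

lemma abs_prod_kernel_le_1: "u \<in> ucube \<Longrightarrow> \<bar>prod_kernel A u x\<bar> \<le> 1"
  unfolding prod_kernel_def abs_prod
  by (intro prod_le_1) (auto intro: abs_sawtooth_le_1 ucube_nth)

lemma borel_measurable_prod_kernel [measurable]: "(\<lambda>u. prod_kernel A u x) \<in> borel_measurable borel"
  unfolding prod_kernel_def by measurable

lemma prod_kernel_vec_upd: "j \<notin> A \<Longrightarrow> prod_kernel A (vec_upd u j t) x = prod_kernel A u x"
  unfolding prod_kernel_def by (intro prod.cong) auto

lemma prod_kernel_insert:
  "j \<notin> A \<Longrightarrow> prod_kernel (insert j A) u x = sawtooth (u $ j) (x $ j) * prod_kernel A u x"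
  by (simp add: prod_kernel_def)

text \<open>
  Unlike Lebesgue measurability, this property passes to the restrictions to all axis-parallel slices and lines.
\<close>

definition bounded_borel_on_ucube :: "(real ^ 'n::finite \<Rightarrow> real) \<Rightarrow> bool" where
  "bounded_borel_on_ucube f \<longleftrightarrow>
     f \<in> borel_measurable (restrict_space borel ucube) \<and> bounded (f ` ucube)"

text \<open>
  All integrands of the expansion have this form: \<open>f\<close> is restricted to the slice through \<open>x\<close> in the
  directions of \<open>S\<close>.  Precomposing with the continuous map onto the slice keeps \<open>f\<close> Borel.
\<close>

lemma bounded_borel_on_ucube_weighted_slice:
  assumes f: "bounded_borel_on_ucube f" and x: "x \<in> ucube"
  shows "bounded_borel_on_ucube (\<lambda>u. prod_kernel A u x * f (merge_coords S u x))"
proof -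
  have "continuous_on UNIV (\<lambda>u. if i \<in> S then u $ i else x $ i)" for i
    by (cases "i \<in> S") (auto intro!: continuous_intros)
  then have "(\<lambda>u. merge_coords S u x) \<in> borel_measurable borel"
    unfolding merge_coords_def by (intro borel_measurable_continuous_onI continuous_on_vec_lambda)
  then have "(\<lambda>u. merge_coords S u x) \<in> restrict_space borel ucube \<rightarrow>\<^sub>M restrict_space borel ucube"
    using merge_coords_in_ucube[OF _ x] by (intro measurable_restrict_space3) auto
  from measurable_compose[OF this] f
  have "(\<lambda>u. prod_kernel A u x * f (merge_coords S u x)) \<in> borel_measurable (restrict_space borel ucube)"
    unfolding bounded_borel_on_ucube_def
    by (intro borel_measurable_times measurable_restrict_space1[OF borel_measurable_prod_kernel]) auto
  moreover obtain B where B: "\<And>u. u \<in> ucube \<Longrightarrow> \<bar>f u\<bar> \<le> B"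
    using f unfolding bounded_borel_on_ucube_def by (auto simp: bounded_iff)
  have "\<bar>prod_kernel A u x * f (merge_coords S u x)\<bar> \<le> 1 * B" if "u \<in> ucube" for u
    unfolding abs_mult
    using abs_prod_kernel_le_1[OF that] B[OF merge_coords_in_ucube[OF that x]] by (intro mult_mono) auto
  then have "bounded ((\<lambda>u. prod_kernel A u x * f (merge_coords S u x)) ` ucube)"
    by (auto simp: bounded_iff)
  ultimately show ?thesis
    by (simp add: bounded_borel_on_ucube_def)
qed

lemma bounded_borel_on_ucube_integrable:
  assumes "bounded_borel_on_ucube f"
  shows "set_integrable lborel ucube f"
  using assms set_integrable_ucube[of f] unfolding bounded_borel_on_ucube_def bounded_iff by auto

text \<open>
  The one-dimensional representation is applied in direction \<open>j\<close> to the value \<open>f (merge_coords S u x)\<close>.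
  The line used passes through \<open>x $ j\<close>, because \<open>j \<notin> S\<close>, and the weight \<open>prod_kernel A u x\<close> is constant
  along it, because \<open>j \<notin> A\<close>.  The new integration variable \<open>t\<close> then takes the place of \<open>u $ j\<close>, on which
  the left-hand integrand does not depend.
\<close>

lemma absorb_coordinate:
  fixes f :: "real ^ 'n::finite \<Rightarrow> real"
  assumes f: "bounded_borel_on_ucube f"
    and d: "partially_differentiable j f"
    and f': "bounded_borel_on_ucube (partial_deriv j f)"
    and x: "x \<in> ucube" and j: "j \<notin> S" "j \<notin> A"
  shows "(LINT u:ucube|lborel. prod_kernel A u x * f (merge_coords S u x)) =
    (LINT u:ucube|lborel. prod_kernel A u x * f (merge_coords (insert j S) u x)) +
    (LINT u:ucube|lborel. prod_kernel (insert j A) u x * partial_deriv j f (merge_coords (insert j S) u x))"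
proof -
  define F G where "F u = prod_kernel A u x * f (merge_coords (insert j S) u x)"
    and "G u = prod_kernel (insert j A) u x * partial_deriv j f (merge_coords (insert j S) u x)" for u
  have FG: "bounded_borel_on_ucube F" "bounded_borel_on_ucube G"
    unfolding F_def G_def by (intro bounded_borel_on_ucube_weighted_slice f f' x)+
  obtain B where B: "\<And>u. u \<in> ucube \<Longrightarrow> \<bar>partial_deriv j f u\<bar> \<le> B"
    using f' unfolding bounded_borel_on_ucube_def by (auto simp: bounded_iff)
  have slice: "prod_kernel A u x * f (merge_coords S u x) =
      (LINT t:{0..1}|lborel. F (vec_upd u j t) + G (vec_upd u j t))" if u: "u \<in> ucube" for u
  proof -
    define y where "y = merge_coords S u x"
    have y: "y \<in> ucube" "y $ j = x $ j"
      using u x j by (auto simp: y_def merge_coords_in_ucube)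
    have "vec_upd y j \<in> restrict_space borel {0..1} \<rightarrow>\<^sub>M restrict_space borel ucube"
      using vec_upd_in_ucube[OF y(1)] by (intro measurable_restrict_space3) auto
    from measurable_compose[OF this] f'
    have meas: "(\<lambda>t. partial_deriv j f (vec_upd y j t)) \<in> borel_measurable (restrict_space borel {0..1})"
      by (auto simp: bounded_borel_on_ucube_def)
    have "f y = f (vec_upd y j (x $ j))"
      by (simp flip: y(2))
    also have "\<dots> = (LINT t:{0..1}|lborel. f (vec_upd y j t) +
        sawtooth t (x $ j) * partial_deriv j f (vec_upd y j t))"
      using partial_deriv_has_derivative[OF d y(1)] meas B vec_upd_in_ucube[OF y(1)]
      by (intro sawtooth_representation ucube_nth x) auto
    finally have "prod_kernel A u x * f y = (LINT t:{0..1}|lborel. prod_kernel A u x *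
        (f (vec_upd y j t) + sawtooth t (x $ j) * partial_deriv j f (vec_upd y j t)))"
      by simp
    also have "\<dots> = (LINT t:{0..1}|lborel. F (vec_upd u j t) + G (vec_upd u j t))"
      using j by (simp add: F_def G_def merge_coords_vec_upd prod_kernel_insert prod_kernel_vec_upd
          algebra_simps flip: y_def)
    finally show ?thesis by (simp add: y_def)
  qed
  obtain BF BG where "\<And>u. u \<in> ucube \<Longrightarrow> \<bar>F u\<bar> \<le> BF" "\<And>u. u \<in> ucube \<Longrightarrow> \<bar>G u\<bar> \<le> BG"
    using FG unfolding bounded_borel_on_ucube_def by (auto simp: bounded_iff)
  then have BFG: "\<bar>F u + G u\<bar> \<le> BF + BG" if "u \<in> ucube" for u
    using that abs_triangle_ineq[of "F u" "G u"] by fastforce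
  have "(LINT u:ucube|lborel. prod_kernel A u x * f (merge_coords S u x)) =
      (LINT u:ucube|lborel. LINT t:{0..1}|lborel. F (vec_upd u j t) + G (vec_upd u j t))"
    by (rule set_lebesgue_integral_cong) (auto simp: slice)
  also have "\<dots> = (LINT u:ucube|lborel. F u + G u)"
    using FG BFG by (intro cube_integral_coordinate[symmetric, where B = "BF + BG"])
      (auto simp: bounded_borel_on_ucube_def)
  also have "\<dots> = (LINT u:ucube|lborel. F u) + (LINT u:ucube|lborel. G u)"
    using FG by (intro set_integral_add bounded_borel_on_ucube_integrable)
  finally show ?thesis
    by (simp add: F_def G_def)
qed

section \<open>Expansion into mixed partial derivatives\<close>

text \<open>
  Indexing by the support instead of the 0-1 sequence allows induction on finite sets.
\<close>

definition set_partial ::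
    "'n::{finite,linorder} set \<Rightarrow> (real ^ 'n::{finite,linorder} \<Rightarrow> real) \<Rightarrow> real ^ 'n::{finite,linorder} \<Rightarrow> real" where
  "set_partial A g = iterated_partial (sorted_list_of_set A) g"

lemma sorted_list_of_set_insert_less:
  fixes j :: "'a::linorder"
  assumes "finite A" "\<forall>a\<in>A. j < a"
  shows "sorted_list_of_set (insert j A) = j # sorted_list_of_set A"
proof -
  have "Min (insert j A) = j"
    using assms by (intro Min_eqI) (auto intro: less_imp_le)
  moreover have "insert j A - {j} = A"
    using assms by auto
  ultimately show ?thesis
    using sorted_list_of_set_nonempty[of "insert j A"] assms(1) by simp
qed

lemma class_G_set_partial:
  fixes g :: "real ^ 'n::{finite,linorder} \<Rightarrow> real"
  assumes "g \<in> class_G"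
  shows "iterated_partial_exists (sorted_list_of_set A) g" "bounded (set_partial A g ` ucube)"
proof -
  define \<alpha> :: "(nat, 'n) vec" where "\<alpha> = (\<chi> i. if i \<in> A then 1 else 0)"
  have "{i. \<alpha> $ i = 1} = A" "\<alpha> \<in> zero_one_seqs"
    by (auto simp: \<alpha>_def zero_one_seqs_def)
  with assms show "iterated_partial_exists (sorted_list_of_set A) g" "bounded (set_partial A g ` ucube)"
    by (auto simp: class_G_def mixed_partial_exists_def mixed_partial_def support_list_def
        set_partial_def class_B_def)
qed

text \<open>
  Here the order of differentiation matters: the smallest index is differentiated last, so only a new
  minimum of the index set leads from one mixed derivative to the next.
\<close>

lemma class_G_set_partial_insert:
  assumes "g \<in> class_G" "\<forall>a\<in>A. j < a"
  shows "set_partial (insert j A) g = partial_deriv j (set_partial A g)"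
    and "partially_differentiable j (set_partial A g)"
  using class_G_set_partial(1)[OF assms(1), of "insert j A"]
  unfolding set_partial_def sorted_list_of_set_insert_less[OF finite assms(2)] by simp_all

lemma class_G_continuous_on:
  assumes "g \<in> class_G"
  shows "continuous_on ucube g"
proof (rule bounded_partials_imp_continuous_on)
  fix i
  show "partially_differentiable i g" "bounded (partial_deriv i g ` ucube)"
    using class_G_set_partial_insert[OF assms, of "{}" i] class_G_set_partial(2)[OF assms, of "{i}"]
    by (simp_all add: set_partial_def)
qed

text \<open>
  Borel measurability starts with the continuous function \<open>g\<close> and propagates to its iterated
  derivatives; it could not be read off from their Lebesgue measurability.
\<close>

lemma class_G_bounded_borel:
  fixes g :: "real ^ 'n::{finite,linorder} \<Rightarrow> real"
  assumes g: "g \<in> class_G"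
  shows "bounded_borel_on_ucube (set_partial A g)"
proof -
  have "set_partial A g \<in> borel_measurable (restrict_space borel ucube)"
    using finite[of A]
  proof (induction A rule: finite_linorder_min_induct)
    case empty
    then show ?case
      using class_G_continuous_on[OF g]
      by (simp add: set_partial_def borel_measurable_continuous_on_restrict)
  next
    case (insert j A)
    then show ?case
      using class_G_set_partial_insert[OF g, of A j] by (simp add: borel_measurable_partial_deriv)
  qed
  then show ?thesis
    using class_G_set_partial(2)[OF g] by (simp add: bounded_borel_on_ucube_def)
qed

text \<open>
  For \<open>S = {}\<close> the right-hand side is the integral of the constant \<open>g x\<close> over a cube of volume 1.  When
  \<open>j\<close> joins \<open>S\<close>, each summand \<open>A \<subseteq> S\<close> splits into the summands for \<open>A\<close> and \<open>insert j A\<close>, which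
  together run over the subsets of \<open>insert j S\<close>.  For \<open>S = UNIV\<close> nothing of \<open>x\<close> is left in the argument
  of the derivatives.
\<close>

lemma class_G_partial_expansion:
  fixes g :: "real ^ 'n::{finite,linorder} \<Rightarrow> real"
  assumes g: "g \<in> class_G" and x: "x \<in> ucube"
  shows "g x = (\<Sum>A\<in>Pow S. LINT u:ucube|lborel. prod_kernel A u x * set_partial A g (merge_coords S u x))"
  using finite[of S]
proof (induction S rule: finite_linorder_min_induct)
  case empty
  show ?case
    by (simp add: prod_kernel_def set_partial_def set_lebesgue_integral_def measure_ucube)
next
  case (insert j S)
  let ?I = "\<lambda>T A. LINT u:ucube|lborel. prod_kernel A u x * set_partial A g (merge_coords T u x)"
  have j: "j \<notin> S"
    using insert.hyps by auto
  have step: "?I S A = ?I (insert j S) A + ?I (insert j S) (insert j A)" if "A \<in> Pow S" for A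
  proof -
    have less: "\<forall>a\<in>A. j < a"
      using that insert.hyps by auto
    then have "j \<notin> A" by auto
    have "partial_deriv j (set_partial A g) = set_partial (insert j A) g"
      using class_G_set_partial_insert(1)[OF g less] by simp
    then show ?thesis
      using absorb_coordinate[OF class_G_bounded_borel[OF g] class_G_set_partial_insert(2)[OF g less]
          _ x j \<open>j \<notin> A\<close>] class_G_bounded_borel[OF g]
      by simp
  qed
  have "g x = (\<Sum>A\<in>Pow S. ?I S A)"
    by (fact insert.IH)
  also have "\<dots> = (\<Sum>A\<in>Pow S. ?I (insert j S) A) + (\<Sum>A\<in>Pow S. ?I (insert j S) (insert j A))"
    by (simp add: step sum.distrib)
  also have "(\<Sum>A\<in>Pow S. ?I (insert j S) (insert j A)) = (\<Sum>A\<in>insert j ` Pow S. ?I (insert j S) A)"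
    using j by (intro sum.reindex_cong[symmetric, OF _ refl]) (auto simp: inj_on_def insert_ident)
  also have "(\<Sum>A\<in>Pow S. ?I (insert j S) A) + \<dots> = (\<Sum>A\<in>Pow (insert j S). ?I (insert j S) A)"
    unfolding Pow_insert using j by (intro sum.union_disjoint[symmetric]) auto
  finally show ?case .
qed

lemma bij_betw_support: "bij_betw (\<lambda>\<alpha>. {i. \<alpha> $ i = 1}) (zero_one_seqs :: (nat ^ 'n::finite) set) UNIV"
proof (rule bij_betw_byWitness[where f' = "\<lambda>A. \<chi> i. if i \<in> A then 1 else 0"])
  show "\<forall>\<alpha>\<in>zero_one_seqs. (\<chi> i. if i \<in> {i. \<alpha> $ i = 1} then 1 else 0) = (\<alpha> :: nat ^ 'n)"
    by (auto simp: vec_eq_iff zero_one_seqs_def)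
qed (auto simp: zero_one_seqs_def)

lemma integral_lebesgue_on_ucube:
  assumes "bounded_borel_on_ucube f"
  shows "integral\<^sup>L (lebesgue_on ucube) f = (LINT u:ucube|lborel. f u)"
proof -
  have "(\<lambda>u. indicator ucube u *\<^sub>R f u) \<in> borel_measurable lborel"
    using assms unfolding bounded_borel_on_ucube_def
    by (subst (asm) borel_measurable_restrict_space_iff) auto
  then show ?thesis
    by (subst integral_restrict_space) (auto simp: set_lebesgue_integral_def integral_completion)
qed

theorem theorem1:
  "\<exists>\<psi> :: nat ^ 'n::{finite,linorder} \<Rightarrow> (real ^ 'n::{finite,linorder} \<Rightarrow> real) \<Rightarrow> (real ^ 'n::{finite,linorder} \<Rightarrow> real).
     \<psi> ` zero_one_seqs \<subseteq> class_K 1 \<and>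
     (\<forall>g\<in>class_G. \<forall>x\<in>ucube. g x = (\<Sum>\<alpha>\<in>zero_one_seqs. \<psi> \<alpha> (mixed_partial \<alpha> g) x))"
proof -
  define \<psi> :: "(nat, 'n) vec \<Rightarrow> ((real, 'n) vec \<Rightarrow> real) \<Rightarrow> ((real, 'n) vec \<Rightarrow> real)"
    where "\<psi> \<alpha> f x = (\<integral>u. prod_kernel {i. \<alpha> $ i = 1} u x * f u \<partial>lebesgue_on ucube)" for \<alpha> f x
  have "\<psi> \<alpha> \<in> class_K 1" for \<alpha>
    unfolding class_K_def
  proof (intro CollectI exI conjI ballI)
    show "(\<lambda>u. prod_kernel {i. \<alpha> $ i = 1} u x) \<in> borel_measurable (lebesgue_on ucube)" for x
      by (intro measurable_restrict_space1 measurable_completion) simp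
    show "\<bar>prod_kernel {i. \<alpha> $ i = 1} u x\<bar> \<le> 1" if "u \<in> ucube" for u x
      using that by (rule abs_prod_kernel_le_1)
    show "\<psi> \<alpha> f x = (\<integral>u. prod_kernel {i. \<alpha> $ i = 1} u x * f u \<partial>lebesgue_on ucube)" for f x
      by (simp add: \<psi>_def)
  qed
  moreover have "g x = (\<Sum>\<alpha>\<in>zero_one_seqs. \<psi> \<alpha> (mixed_partial \<alpha> g) x)"
    if g: "g \<in> class_G" and x: "x \<in> ucube" for g x
  proof -
    have "\<psi> \<alpha> (mixed_partial \<alpha> g) x = (LINT u:ucube|lborel.
        prod_kernel {i. \<alpha> $ i = 1} u x * set_partial {i. \<alpha> $ i = 1} g (merge_coords UNIV u x))" for \<alpha>
      unfolding \<psi>_def mixed_partial_def support_list_def set_partial_def[symmetric]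
      using integral_lebesgue_on_ucube[OF bounded_borel_on_ucube_weighted_slice[OF
          class_G_bounded_borel[OF g] x, where S = UNIV]]
      by simp
    then show ?thesis
      using class_G_partial_expansion[OF g x, of UNIV]
      by (simp add: sum.reindex_bij_betw[OF bij_betw_support, symmetric])
  qed
  ultimately show ?thesis
    by (intro exI[of _ \<psi>]) auto
qed

end
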